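(* (1) Let $\mathcal G$ be a solvable Lie algebra of dimension $2n+1$, $n\geq1$, admitting a contact form, and suppose that its derived ideal $\mathcal N:=[\mathcal G,\mathcal G]$ has codimension $1$ in $\mathcal G$. Then the following hold. (a) The center $Z(\mathcal N)$ of $\mathcal N$ has dimension $\dim Z(\mathcal N)\leq 2$. If moreover $\dim Z(\mathcal N)=2$, then there exists $e\in\mathcal G$ such that $Z(\mathcal N)$ is not an eigenspace of $ad_e$, i.e. there is no $\lambda\in\mathbb R$ with $[e,x]=\lambda x$ for all $x\in Z(\mathcal N)$. (b) There is a linear form $\alpha$ on $\mathcal N$ with $(\partial\alpha)^{n-1}\wedge\alpha\neq0$. (2) If a Lie algebra $\mathcal G$ has a codimension $1$ abelian subalgebra and $\dim(\mathcal G)\geq4$, then $\mathcal G$ has neither a contact form nor an exact symplectic form.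
   Context: All Lie algebras are real and finite dimensional. For a linear form $\eta$ on a Lie algebra, $\partial\eta(x,y):=-\eta([x,y])$. A contact form on a Lie algebra of dimension $2n+1$ is a linear form $\eta$ with $(\partial\eta)^n\wedge\eta\neq0$. An exact symplectic form on a Lie algebra is a nondegenerate 2-form of the type $\partial\alpha$ for some linear form $\alpha$. *)

theory Defs
  imports Complex_Main "HOL-Combinatorics.Permutations"
begin

text \<open>
  A Lie algebra is given by a carrier \<open>G\<close>, a finite-dimensional subspace of some real vector
  space, and a bracket that is only constrained on \<open>G\<close>. This way a subalgebra of \<open>G\<close> is a
  Lie algebra with the same bracket.
\<close>

locale lie_algebra =
  fixes G :: "'a::real_vector set" and br :: "'a \<Rightarrow> 'a \<Rightarrow> 'a"
  assumes subspace_carrier: "subspace G"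
    and finite_dimensional: "\<exists>B. finite B \<and> G \<subseteq> span B"
    and bracket_closed: "\<lbrakk>x \<in> G; y \<in> G\<rbrakk> \<Longrightarrow> br x y \<in> G"
    and bracket_add_left: "\<lbrakk>x \<in> G; y \<in> G; z \<in> G\<rbrakk> \<Longrightarrow> br (x + y) z = br x z + br y z"
    and bracket_add_right: "\<lbrakk>x \<in> G; y \<in> G; z \<in> G\<rbrakk> \<Longrightarrow> br x (y + z) = br x y + br x z"
    and bracket_scale_left: "\<lbrakk>x \<in> G; y \<in> G\<rbrakk> \<Longrightarrow> br (c *\<^sub>R x) y = c *\<^sub>R br x y"
    and bracket_scale_right: "\<lbrakk>x \<in> G; y \<in> G\<rbrakk> \<Longrightarrow> br x (c *\<^sub>R y) = c *\<^sub>R br x y"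
    and bracket_alternating: "x \<in> G \<Longrightarrow> br x x = 0"
    and jacobi: "\<lbrakk>x \<in> G; y \<in> G; z \<in> G\<rbrakk> \<Longrightarrow>
      br x (br y z) + br y (br z x) + br z (br x y) = 0"

definition derived_ideal :: "'a::real_vector set \<Rightarrow> ('a \<Rightarrow> 'a \<Rightarrow> 'a) \<Rightarrow> 'a set"
  where "derived_ideal G br = span {br x y | x y. x \<in> G \<and> y \<in> G}"

primrec derived_series :: "'a::real_vector set \<Rightarrow> ('a \<Rightarrow> 'a \<Rightarrow> 'a) \<Rightarrow> nat \<Rightarrow> 'a set"
  where
    "derived_series G br 0 = G"
  | "derived_series G br (Suc k) = derived_ideal (derived_series G br k) br"

definition solvable_lie_algebra :: "'a::real_vector set \<Rightarrow> ('a \<Rightarrow> 'a \<Rightarrow> 'a) \<Rightarrow> bool"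
  where "solvable_lie_algebra G br \<longleftrightarrow>
    lie_algebra G br \<and> (\<exists>k. derived_series G br k = {0})"

definition lie_center :: "'a::real_vector set \<Rightarrow> ('a \<Rightarrow> 'a \<Rightarrow> 'a) \<Rightarrow> 'a set"
  where "lie_center G br = {x \<in> G. \<forall>y \<in> G. br x y = 0}"

definition lie_subalgebra :: "'a::real_vector set \<Rightarrow> 'a set \<Rightarrow> ('a \<Rightarrow> 'a \<Rightarrow> 'a) \<Rightarrow> bool"
  where "lie_subalgebra H G br \<longleftrightarrow>
    subspace H \<and> H \<subseteq> G \<and> (\<forall>x \<in> H. \<forall>y \<in> H. br x y \<in> H)"

definition abelian_on :: "'a::real_vector set \<Rightarrow> ('a \<Rightarrow> 'a \<Rightarrow> 'a) \<Rightarrow> bool"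
  where "abelian_on H br \<longleftrightarrow> (\<forall>x \<in> H. \<forall>y \<in> H. br x y = 0)"

definition linear_form_on :: "'a::real_vector set \<Rightarrow> ('a \<Rightarrow> real) \<Rightarrow> bool"
  where "linear_form_on G \<eta> \<longleftrightarrow>
    (\<forall>x \<in> G. \<forall>y \<in> G. \<eta> (x + y) = \<eta> x + \<eta> y) \<and>
    (\<forall>c. \<forall>x \<in> G. \<eta> (c *\<^sub>R x) = c * \<eta> x)"

text \<open>
  A form of degree \<open>k\<close> is a function of a sequence \<open>v\<close> of vectors that only reads
  \<open>v 0, \<dots>, v (k - 1)\<close>; the degrees are passed explicitly to the wedge product. It is a form on
  the carrier \<open>G\<close> through its values on sequences in \<open>G\<close>.
\<close>

type_synonym 'a form = "(nat \<Rightarrow> 'a) \<Rightarrow> real"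

definition form1 :: "('a \<Rightarrow> real) \<Rightarrow> 'a form"
  where "form1 \<eta> = (\<lambda>v. \<eta> (v 0))"

definition form2 :: "('a \<Rightarrow> 'a \<Rightarrow> real) \<Rightarrow> 'a form"
  where "form2 \<omega> = (\<lambda>v. \<omega> (v 0) (v 1))"

definition wedge :: "nat \<Rightarrow> nat \<Rightarrow> 'a form \<Rightarrow> 'a form \<Rightarrow> 'a form"
  where "wedge k l \<phi> \<psi> = (\<lambda>v.
    (\<Sum>\<sigma> | \<sigma> permutes {..<k + l}.
      of_int (sign \<sigma>) * \<phi> (\<lambda>i. v (\<sigma> i)) * \<psi> (\<lambda>i. v (\<sigma> (k + i)))) / (fact k * fact l))"

primrec wedge_power :: "nat \<Rightarrow> 'a form \<Rightarrow> nat \<Rightarrow> 'a form"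
  where
    "wedge_power k \<phi> 0 = (\<lambda>v. 1)"
  | "wedge_power k \<phi> (Suc m) = wedge k (k * m) \<phi> (wedge_power k \<phi> m)"

definition nonzero_form_on :: "'a set \<Rightarrow> 'a form \<Rightarrow> bool"
  where "nonzero_form_on G \<phi> \<longleftrightarrow> (\<exists>v. range v \<subseteq> G \<and> \<phi> v \<noteq> 0)"

definition lie_d :: "('a \<Rightarrow> 'a \<Rightarrow> 'a) \<Rightarrow> ('a \<Rightarrow> real) \<Rightarrow> 'a \<Rightarrow> 'a \<Rightarrow> real"
  where "lie_d br \<eta> x y = - \<eta> (br x y)"

text \<open>\<open>(\<partial>\<eta>)\<^sup>m \<and> \<eta>\<close>, of degree \<open>2 m + 1\<close>\<close>
definition contact_power :: "('a \<Rightarrow> 'a \<Rightarrow> 'a) \<Rightarrow> nat \<Rightarrow> ('a \<Rightarrow> real) \<Rightarrow> 'a form"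
  where "contact_power br m \<eta> =
    wedge (2 * m) 1 (wedge_power 2 (form2 (lie_d br \<eta>)) m) (form1 \<eta>)"

definition contact_form :: "'a::real_vector set \<Rightarrow> ('a \<Rightarrow> 'a \<Rightarrow> 'a) \<Rightarrow> ('a \<Rightarrow> real) \<Rightarrow> bool"
  where "contact_form G br \<eta> \<longleftrightarrow> linear_form_on G \<eta> \<and>
    (\<exists>n. dim G = 2 * n + 1 \<and> nonzero_form_on G (contact_power br n \<eta>))"

definition nondegenerate_on :: "'a::real_vector set \<Rightarrow> ('a \<Rightarrow> 'a \<Rightarrow> real) \<Rightarrow> bool"
  where "nondegenerate_on G \<omega> \<longleftrightarrow> (\<forall>x \<in> G. (\<forall>y \<in> G. \<omega> x y = 0) \<longrightarrow> x = 0)"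

definition exact_symplectic_form ::
  "'a::real_vector set \<Rightarrow> ('a \<Rightarrow> 'a \<Rightarrow> 'a) \<Rightarrow> ('a \<Rightarrow> 'a \<Rightarrow> real) \<Rightarrow> bool"
  where "exact_symplectic_form G br \<omega> \<longleftrightarrow> nondegenerate_on G \<omega> \<and>
    (\<exists>\<alpha>. linear_form_on G \<alpha> \<and> (\<forall>x \<in> G. \<forall>y \<in> G. \<omega> x y = lie_d br \<alpha> x y))"

end

theory Submission imports Defs begin

text \<open>
  Everything rests on one property of a contact form \<open>\<eta>\<close> (\<open>contact_form_radical\<close>): no nonzero
  vector \<open>x\<close> satisfies both \<open>\<eta> x = 0\<close> and \<open>i\<^sub>x \<partial>\<eta> = 0\<close>. Indeed \<open>(\<partial>\<eta>)\<^sup>n \<and> \<eta>\<close> is an alternating form of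
  top degree, so if it is nonzero it is nonzero on some basis containing \<open>x\<close>;
  but \<open>x\<close> annihilates each of its factors.

  Let \<open>H\<close> be a subspace of codimension \<open>1\<close> and \<open>G = H + \<real> e\<close>. An element \<open>x\<close> of \<open>H\<close> that commutes with \<open>H\<close>
  lies in the radical of \<open>\<partial>\<eta>\<close> as soon as \<open>\<eta> [x, e] = 0\<close>. So \<open>\<eta>\<close> and \<open>x \<mapsto> \<eta> [x, e]\<close> are two linear
  forms without common nonzero zero on the center of \<open>H\<close>. Counting dimensions gives the bound \<open>2\<close>, the
  statement about eigenspaces, and, for abelian \<open>H\<close>, the absence of contact forms in dimension at
  least \<open>4\<close>. The same count with only the second form excludes exact symplectic forms
  (\<open>contact_center_hyperplane\<close>, \<open>abelian_hyperplane_obstruction\<close>).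

  The linear form on \<open>N = [G, G]\<close> with \<open>(\<partial>\<alpha>)\<^sup>n\<^sup>-\<^sup>1 \<and> \<alpha> \<noteq> 0\<close> is the restriction of \<open>\<eta>\<close>
  (\<open>contact_form_derived_ideal\<close>). The kernel of \<open>\<eta>\<close> is not \<open>N\<close>, since otherwise \<open>\<partial>\<eta> = 0\<close>. Hence \<open>ker \<eta>\<close>
  contains some \<open>e\<close> outside \<open>N\<close>, and contraction gives
  \<open>i\<^sub>e ((\<partial>\<eta>)\<^sup>n \<and> \<eta>) = n i\<^sub>e \<partial>\<eta> \<and> (\<partial>\<eta>)\<^sup>n\<^sup>-\<^sup>1 \<and> \<eta>\<close>. The left-hand side is nonzero on \<open>N\<close>
  because \<open>e\<close> and \<open>N\<close> span \<open>G\<close>, so \<open>(\<partial>\<eta>)\<^sup>n\<^sup>-\<^sup>1 \<and> \<eta>\<close> is nonzero on \<open>N\<close> too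
  (\<open>contact_sum_zero_reduction\<close>, \<open>contact_sum_nonzero_on_hyperplane\<close>).

  To evaluate and contract these forms, the iterated wedge products are first rewritten as one signed
  sum over all permutations, whose term is a product of values of \<open>\<partial>\<eta>\<close> on consecutive pairs of arguments
  and one value of \<open>\<eta>\<close> (\<open>contact_power_eq_contact_sum\<close>).
\<close>

section \<open>Signed sums over permutations\<close>

text \<open>
  The argument is a function of the permutation itself rather than of a permuted tuple of
  vectors, so that conditions such as "\<open>\<sigma>\<close> sends position \<open>p\<close> to index \<open>j\<close>" can be part of the
  summand.
\<close>

definition signed_sum :: "nat \<Rightarrow> ((nat \<Rightarrow> nat) \<Rightarrow> real) \<Rightarrow> real"
  where "signed_sum n g = (\<Sum>\<sigma> | \<sigma> permutes {..<n}. of_int (sign \<sigma>) * g \<sigma>)"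

lemma signed_sum_cong:
  "(\<And>\<sigma>. \<sigma> permutes {..<n} \<Longrightarrow> f \<sigma> = g \<sigma>) \<Longrightarrow> signed_sum n f = signed_sum n g"
  unfolding signed_sum_def by (rule sum.cong) auto

lemma signed_sum_zero: "(\<And>\<sigma>. \<sigma> permutes {..<n} \<Longrightarrow> g \<sigma> = 0) \<Longrightarrow> signed_sum n g = 0"
  unfolding signed_sum_def by (rule sum.neutral) auto

lemma signed_sum_scale: "signed_sum n (\<lambda>\<sigma>. c * g \<sigma>) = c * signed_sum n g"
  unfolding signed_sum_def by (simp add: sum_distrib_left mult.left_commute)

lemma signed_sum_add: "signed_sum n (\<lambda>\<sigma>. f \<sigma> + g \<sigma>) = signed_sum n f + signed_sum n g"
  unfolding signed_sum_def by (simp add: distrib_left sum.distrib)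

lemma signed_sum_sum: "signed_sum n (\<lambda>\<sigma>. \<Sum>p\<in>A. g p \<sigma>) = (\<Sum>p\<in>A. signed_sum n (g p))"
  unfolding signed_sum_def by (simp add: sum_distrib_left) (rule sum.swap)

lemma signed_sum_compose:
  assumes "\<pi> permutes {..<n}"
  shows "signed_sum n (\<lambda>\<sigma>. g (\<sigma> \<circ> \<pi>)) = of_int (sign \<pi>) * signed_sum n g"
proof -
  have "signed_sum n g = (\<Sum>\<sigma> | \<sigma> permutes {..<n}. of_int (sign (\<sigma> \<circ> \<pi>)) * g (\<sigma> \<circ> \<pi>))"
    unfolding signed_sum_def by (rule sum_permutations_compose_right[OF assms])
  also have "\<dots> = (\<Sum>\<sigma> | \<sigma> permutes {..<n}.
      of_int (sign \<pi>) * (of_int (sign \<sigma>) * g (\<sigma> \<circ> \<pi>)))"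
    by (rule sum.cong) (use assms in \<open>auto simp: sign_compose permutes_imp_permutation[OF finite_lessThan] mult_ac\<close>)
  also have "\<dots> = of_int (sign \<pi>) * signed_sum n (\<lambda>\<sigma>. g (\<sigma> \<circ> \<pi>))"
    unfolding signed_sum_def by (simp add: sum_distrib_left)
  finally have "of_int (sign \<pi>) * signed_sum n g =
      of_int (sign \<pi> * sign \<pi>) * signed_sum n (\<lambda>\<sigma>. g (\<sigma> \<circ> \<pi>))"
    by (simp only: of_int_mult mult.assoc)
  then show ?thesis by simp
qed

text \<open>
  Each permutation \<open>h \<tau>\<close> contributes a reindexed copy of the same sum, so an antisymmetrisation
  nested in a signed sum only multiplies it by \<open>l!\<close>. This collapses iterated wedge products, and,
  read backwards, creates an inner antisymmetrisation where a lower form is to be recognised.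
\<close>

lemma signed_sum_average:
  assumes "\<And>\<tau>. \<tau> permutes {..<l} \<Longrightarrow> h \<tau> permutes {..<n} \<and> sign (h \<tau>) = sign \<tau>"
  shows "signed_sum n (\<lambda>\<sigma>. signed_sum l (\<lambda>\<tau>. g (\<sigma> \<circ> h \<tau>))) = fact l * signed_sum n g"
proof -
  have "signed_sum n (\<lambda>\<sigma>. signed_sum l (\<lambda>\<tau>. g (\<sigma> \<circ> h \<tau>))) =
      (\<Sum>\<tau> | \<tau> permutes {..<l}. of_int (sign \<tau>) * signed_sum n (\<lambda>\<sigma>. g (\<sigma> \<circ> h \<tau>)))"
    unfolding signed_sum_def[of l] by (simp add: signed_sum_sum signed_sum_scale)
  also have "\<dots> = (\<Sum>\<tau> | \<tau> permutes {..<l}. signed_sum n g)"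
  proof (rule sum.cong)
    fix \<tau> assume "\<tau> \<in> {\<tau>. \<tau> permutes {..<l}}"
    then have "h \<tau> permutes {..<n}" "sign (h \<tau>) = sign \<tau>" using assms by auto
    then have "of_int (sign \<tau>) * signed_sum n (\<lambda>\<sigma>. g (\<sigma> \<circ> h \<tau>)) =
        of_int (sign \<tau> * sign \<tau>) * signed_sum n g"
      by (simp only: signed_sum_compose of_int_mult mult.assoc)
    then show "of_int (sign \<tau>) * signed_sum n (\<lambda>\<sigma>. g (\<sigma> \<circ> h \<tau>)) = signed_sum n g"
      by simp
  qed simp
  also have "\<dots> = fact l * signed_sum n g"
    by (simp add: card_permutations)
  finally show ?thesis .
qed

text \<open>
  This is how a permutation of the arguments of the second factor of a wedge product, whose first
  factor has degree \<open>k\<close>, acts on the arguments of the product.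
\<close>

definition shift_permutation :: "nat \<Rightarrow> nat \<Rightarrow> (nat \<Rightarrow> nat) \<Rightarrow> nat \<Rightarrow> nat"
  where "shift_permutation k l \<tau> = map_permutation {..<l} ((+) k) \<tau>"

lemma shift_permutation:
  assumes "\<tau> permutes {..<l}"
  shows "shift_permutation k l \<tau> permutes {k..<k + l}"
    and "sign (shift_permutation k l \<tau>) = sign \<tau>"
    and "i < l \<Longrightarrow> shift_permutation k l \<tau> (k + i) = k + \<tau> i"
    and "i < k \<Longrightarrow> shift_permutation k l \<tau> i = i"
proof -
  have b: "bij_betw ((+) k) {..<l} {k..<k + l}"
    by (simp add: bij_betw_def image_add_atLeastLessThan lessThan_atLeast0 add.commute)
  show p: "shift_permutation k l \<tau> permutes {k..<k + l}"
    unfolding shift_permutation_def by (rule map_permutation_permutes[OF b assms])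
  show "sign (shift_permutation k l \<tau>) = sign \<tau>"
    unfolding shift_permutation_def by (rule sign_map_permutation) (use assms in auto)
  show "i < l \<Longrightarrow> shift_permutation k l \<tau> (k + i) = k + \<tau> i"
    unfolding shift_permutation_def by (rule map_permutation_apply) auto
  show "i < k \<Longrightarrow> shift_permutation k l \<tau> i = i"
    by (rule permutes_not_in[OF p]) simp
qed

lemma signed_sum_average_shift:
  assumes "k + l \<le> n"
  shows "signed_sum n (\<lambda>\<sigma>. signed_sum l (\<lambda>\<tau>. g (\<sigma> \<circ> shift_permutation k l \<tau>))) =
    fact l * signed_sum n g"
proof (rule signed_sum_average)
  fix \<tau> assume "\<tau> permutes {..<l}"
  then show "shift_permutation k l \<tau> permutes {..<n} \<and>
      sign (shift_permutation k l \<tau>) = sign \<tau>"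
    using assms by (auto simp: shift_permutation intro: permutes_subset[OF shift_permutation(1)])
qed

section \<open>Explicit formula for powers of two-forms and contact powers\<close>

lemma wedge_signed_sum:
  "wedge k l \<phi> \<psi> v =
    signed_sum (k + l) (\<lambda>\<sigma>. \<phi> (v \<circ> \<sigma>) * \<psi> (\<lambda>i. v (\<sigma> (k + i)))) / (fact k * fact l)"
  unfolding wedge_def signed_sum_def by (simp add: o_def mult.assoc)

text \<open>
  For antisymmetric \<open>\<omega>\<close>, the signed sum of this product over all permutations of \<open>2 m\<close> arguments is
  \<open>2\<^sup>m m!\<close> times the Pfaffian of the matrix \<open>\<omega> (w i) (w j)\<close>.
\<close>

definition pairing :: "('a \<Rightarrow> 'a \<Rightarrow> real) \<Rightarrow> nat \<Rightarrow> 'a form"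
  where "pairing \<omega> m w = (\<Prod>i<m. \<omega> (w (2 * i)) (w (2 * i + 1)))"

lemma pairing_cong: "(\<And>i. i < 2 * m \<Longrightarrow> v i = w i) \<Longrightarrow> pairing \<omega> m v = pairing \<omega> m w"
  unfolding pairing_def by (rule prod.cong) auto

lemma pairing_Suc_front:
  "pairing \<omega> (Suc m) w = \<omega> (w 0) (w 1) * pairing \<omega> m (\<lambda>i. w (2 + i))"
  unfolding pairing_def by (subst prod.lessThan_Suc_shift) (simp add: o_def)

lemma pairing_Suc:
  "pairing \<omega> (Suc m) w = pairing \<omega> m w * \<omega> (w (2 * m)) (w (2 * m + 1))"
  unfolding pairing_def by simp

text \<open>
  In the recursion for the power the inner factor is already a signed sum over the last \<open>2 m\<close>
  arguments, which averaging absorbs into the outer one.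
\<close>

lemma wedge_power_eq_signed_sum:
  "wedge_power 2 (form2 \<omega>) m v = signed_sum (2 * m) (\<lambda>\<sigma>. pairing \<omega> m (v \<circ> \<sigma>)) / 2 ^ m"
proof (induction m arbitrary: v)
  case 0
  show ?case by (simp add: signed_sum_def pairing_def)
next
  case (Suc m)
  let ?g = "\<lambda>\<sigma>. pairing \<omega> (Suc m) (v \<circ> \<sigma>)"
  have *: "form2 \<omega> (v \<circ> \<sigma>) * wedge_power 2 (form2 \<omega>) m (\<lambda>i. v (\<sigma> (2 + i))) =
      (1 / 2 ^ m) * signed_sum (2 * m) (\<lambda>\<tau>. ?g (\<sigma> \<circ> shift_permutation 2 (2 * m) \<tau>))" for \<sigma>
  proof -
    have "?g (\<sigma> \<circ> shift_permutation 2 (2 * m) \<tau>) =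
        form2 \<omega> (v \<circ> \<sigma>) * pairing \<omega> m ((\<lambda>i. v (\<sigma> (2 + i))) \<circ> \<tau>)"
      if "\<tau> permutes {..<2 * m}" for \<tau>
    proof -
      have "pairing \<omega> m (\<lambda>i. v (\<sigma> (shift_permutation 2 (2 * m) \<tau> (2 + i)))) =
          pairing \<omega> m ((\<lambda>i. v (\<sigma> (2 + i))) \<circ> \<tau>)"
        by (rule pairing_cong) (simp only: o_def shift_permutation(3)[OF that])
      then show ?thesis
        unfolding pairing_Suc_front form2_def using shift_permutation(4)[OF that, of 0 2]
          shift_permutation(4)[OF that, of 1 2]
        by (simp add: o_def)
    qed
    then have "signed_sum (2 * m) (\<lambda>\<tau>. ?g (\<sigma> \<circ> shift_permutation 2 (2 * m) \<tau>)) =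
        form2 \<omega> (v \<circ> \<sigma>) * signed_sum (2 * m) (\<lambda>\<tau>. pairing \<omega> m ((\<lambda>i. v (\<sigma> (2 + i))) \<circ> \<tau>))"
      by (simp add: signed_sum_scale cong: signed_sum_cong)
    then show ?thesis unfolding Suc.IH by simp
  qed
  have "wedge_power 2 (form2 \<omega>) (Suc m) v =
      (1 / 2 ^ m) * (fact (2 * m) * signed_sum (2 + 2 * m) ?g) / (fact 2 * fact (2 * m))"
    unfolding wedge_power.simps wedge_signed_sum *
    by (simp only: signed_sum_scale signed_sum_average_shift[OF order_refl, where g = ?g])
  then show ?case by (simp add: o_def mult.commute)
qed

definition contact_term :: "('a \<Rightarrow> 'a \<Rightarrow> real) \<Rightarrow> ('a \<Rightarrow> real) \<Rightarrow> nat \<Rightarrow> 'a form"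
  where "contact_term \<omega> \<eta> m w = pairing \<omega> m w * \<eta> (w (2 * m))"

text \<open>
  This is \<open>2\<^sup>m\<close> times \<open>\<omega>\<^sup>m \<and> \<eta>\<close>. In this form all \<open>m\<close> pairs of arguments can be interchanged, a
  symmetry that the recursive wedge power hides.
\<close>

definition contact_sum :: "('a \<Rightarrow> 'a \<Rightarrow> real) \<Rightarrow> ('a \<Rightarrow> real) \<Rightarrow> nat \<Rightarrow> 'a form"
  where "contact_sum \<omega> \<eta> m v = signed_sum (2 * m + 1) (\<lambda>\<sigma>. contact_term \<omega> \<eta> m (v \<circ> \<sigma>))"

lemma contact_power_eq_contact_sum:
  "contact_power br m \<eta> v = contact_sum (lie_d br \<eta>) \<eta> m v / 2 ^ m"
proof -
  let ?\<omega> = "lie_d br \<eta>"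
  let ?g = "\<lambda>\<sigma>. contact_term ?\<omega> \<eta> m (v \<circ> \<sigma>)"
  have *: "wedge_power 2 (form2 ?\<omega>) m (v \<circ> \<sigma>) * form1 \<eta> (\<lambda>i. v (\<sigma> (2 * m + i))) =
      (1 / 2 ^ m) * signed_sum (2 * m) (\<lambda>\<tau>. ?g (\<sigma> \<circ> shift_permutation 0 (2 * m) \<tau>))" for \<sigma>
  proof -
    have "?g (\<sigma> \<circ> shift_permutation 0 (2 * m) \<tau>) =
        form1 \<eta> (\<lambda>i. v (\<sigma> (2 * m + i))) * pairing ?\<omega> m (v \<circ> \<sigma> \<circ> \<tau>)"
      if "\<tau> permutes {..<2 * m}" for \<tau>
    proof -
      have "pairing ?\<omega> m (v \<circ> \<sigma> \<circ> shift_permutation 0 (2 * m) \<tau>) = pairing ?\<omega> m (v \<circ> \<sigma> \<circ> \<tau>)"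
        by (rule pairing_cong) (use shift_permutation(3)[OF that, of _ 0] in simp)
      moreover have "shift_permutation 0 (2 * m) \<tau> (2 * m) = 2 * m"
        by (rule permutes_not_in[OF shift_permutation(1)[OF that]]) simp
      ultimately show ?thesis by (simp add: contact_term_def form1_def o_assoc)
    qed
    then have "signed_sum (2 * m) (\<lambda>\<tau>. ?g (\<sigma> \<circ> shift_permutation 0 (2 * m) \<tau>)) =
        form1 \<eta> (\<lambda>i. v (\<sigma> (2 * m + i))) * signed_sum (2 * m) (\<lambda>\<tau>. pairing ?\<omega> m (v \<circ> \<sigma> \<circ> \<tau>))"
      by (simp add: signed_sum_scale cong: signed_sum_cong)
    then show ?thesis by (simp add: wedge_power_eq_signed_sum)
  qed
  have "contact_power br m \<eta> v =
      (1 / 2 ^ m) * (fact (2 * m) * signed_sum (2 * m + 1) ?g) / (fact (2 * m) * fact 1)"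
    unfolding contact_power_def wedge_signed_sum *
    by (simp only: signed_sum_scale
        signed_sum_average_shift[of 0 "2 * m" "2 * m + 1" ?g, unfolded add_0, OF le_add1])
  then show ?thesis by (simp add: contact_sum_def)
qed

section \<open>Linear forms and hyperplanes\<close>

lemma linear_form_on_zero: "linear_form_on G f \<Longrightarrow> 0 \<in> G \<Longrightarrow> f 0 = 0"
  unfolding linear_form_on_def by (metis mult_zero_left scaleR_zero_left)

lemma linear_form_on_neg:
  assumes "linear_form_on G \<eta>" "x \<in> G"
  shows "\<eta> (- x) = - \<eta> x"
proof -
  have "\<eta> ((-1) *\<^sub>R x) = (-1) * \<eta> x"
    using assms unfolding linear_form_on_def by blast
  then show ?thesis by simp
qed

lemma linear_form_on_diff_scale:
  assumes "linear_form_on G f" "subspace G" "x \<in> G" "y \<in> G"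
  shows "f (x - c *\<^sub>R y) = f x - c * f y"
proof -
  have "f (x + (- c) *\<^sub>R y) = f x + f ((- c) *\<^sub>R y)"
    using assms unfolding linear_form_on_def by (meson subspace_scale)
  moreover have "f ((- c) *\<^sub>R y) = - c * f y"
    using assms unfolding linear_form_on_def by blast
  ultimately show ?thesis by simp
qed

lemma linear_form_on_sum:
  assumes "linear_form_on G f" "subspace G" "S \<subseteq> G"
  shows "f (\<Sum>s\<in>S. u s *\<^sub>R s) = (\<Sum>s\<in>S. u s * f s)"
  using assms(3)
proof (induction S rule: infinite_finite_induct)
  case (insert s S)
  have "(\<Sum>s\<in>S. u s *\<^sub>R s) \<in> G" "u s *\<^sub>R s \<in> G"
    using insert.prems assms(2) by (auto intro!: subspace_sum subspace_scale)
  then show ?case using insert assms(1) by (simp add: linear_form_on_def)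
qed (use linear_form_on_zero[OF assms(1)] subspace_0[OF assms(2)] in auto)

lemma linear_form_on_subset: "linear_form_on G f \<Longrightarrow> H \<subseteq> G \<Longrightarrow> linear_form_on H f"
  unfolding linear_form_on_def by blast

lemma linear_form_on_mult_left: "linear_form_on G f \<Longrightarrow> linear_form_on G (\<lambda>x. c * f x)"
  unfolding linear_form_on_def by (simp add: distrib_left mult.left_commute)

lemma linear_form_on_mult_right: "linear_form_on G f \<Longrightarrow> linear_form_on G (\<lambda>x. f x * c)"
  unfolding linear_form_on_def by (simp add: distrib_right)

lemma linear_form_on_signed_sum:
  assumes "\<And>\<sigma>. \<sigma> permutes {..<n} \<Longrightarrow> linear_form_on G (\<lambda>x. g x \<sigma>)"
  shows "linear_form_on G (\<lambda>x. signed_sum n (g x))"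
proof -
  have "signed_sum n (g (x + y)) = signed_sum n (\<lambda>\<sigma>. g x \<sigma> + g y \<sigma>)" if "x \<in> G" "y \<in> G" for x y
    by (rule signed_sum_cong) (use assms that in \<open>auto simp: linear_form_on_def\<close>)
  moreover have "signed_sum n (g (c *\<^sub>R x)) = signed_sum n (\<lambda>\<sigma>. c * g x \<sigma>)" if "x \<in> G" for c x
    by (rule signed_sum_cong) (use assms that in \<open>auto simp: linear_form_on_def\<close>)
  ultimately show ?thesis
    unfolding linear_form_on_def by (simp add: signed_sum_add signed_sum_scale)
qed

lemma finite_dimensional_subset_card:
  assumes "G \<subseteq> span B" "finite B" "independent S" "S \<subseteq> G"
  shows "finite S \<and> card S \<le> dim G"
proof -
  obtain C where C: "C \<subseteq> G" "independent C" "G \<subseteq> span C" "card C = dim G"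
    using basis_exists by blast
  then have "finite C" using independent_span_bound[OF assms(2)] assms(1) by blast
  then show ?thesis using independent_span_bound[of C S] C assms by auto
qed

text \<open>
  The ambient space may be infinite-dimensional, hence the explicit finite spanning set.
\<close>

lemma independent_dim_spans:
  assumes "G \<subseteq> span B" "finite B" "independent S" "S \<subseteq> G" "card S = dim G"
  shows "G \<subseteq> span S"
proof
  fix x assume x: "x \<in> G"
  show "x \<in> span S"
  proof (rule ccontr)
    assume n: "x \<notin> span S"
    then have "independent (insert x S)" by (rule independent_insertI[OF _ assms(3)])
    moreover have "insert x S \<subseteq> G" using x assms(4) by simp
    ultimately have "finite (insert x S) \<and> card (insert x S) \<le> dim G"
      by (rule finite_dimensional_subset_card[OF assms(1,2)])
    moreover have "x \<notin> S" using n span_base by blast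
    ultimately show False using assms(5) by auto
  qed
qed

text \<open>
  A basis of \<open>N\<close> together with \<open>e\<close> is independent of cardinality \<open>dim G\<close>, hence spans \<open>G\<close>.
\<close>

lemma hyperplane_complement:
  assumes G: "subspace G" "G \<subseteq> span B" "finite B" and N: "subspace N" "N \<subseteq> G" "dim N + 1 = dim G"
  shows "\<exists>e. e \<in> G \<and> e \<notin> N"
    and "e \<in> G \<Longrightarrow> e \<notin> N \<Longrightarrow> y \<in> G \<Longrightarrow> \<exists>t. y - t *\<^sub>R e \<in> N"
proof -
  show "\<exists>e. e \<in> G \<and> e \<notin> N"
  proof (rule ccontr)
    assume "\<not> ?thesis"
    then have "N = G" using N(2) by blast
    with N(3) show False by simp
  qed
  assume e: "e \<in> G" "e \<notin> N" and y: "y \<in> G"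
  obtain C where C: "C \<subseteq> N" "independent C" "N \<subseteq> span C" "card C = dim N"
    using basis_exists by blast
  have spanC: "span C = N" using C(1,3) span_minimal[OF C(1) N(1)] by blast
  have "finite C" using finite_dimensional_subset_card[OF G(2,3) C(2)] C(1) N(2) by blast
  moreover have "e \<notin> C" using e C(1) by blast
  ultimately have "card (insert e C) = dim G" using C(4) N(3) by simp
  moreover have "independent (insert e C)"
    using e spanC by (intro independent_insertI C(2)) simp
  ultimately have "G \<subseteq> span (insert e C)"
    using C(1) N(2) e(1) by (intro independent_dim_spans[OF G(2,3)]) auto
  then show "\<exists>t. y - t *\<^sub>R e \<in> N"
    using y spanC by (auto simp: span_insert)
qed

text \<open>
  If \<open>f a \<noteq> 0\<close>, a basis of the kernel together with \<open>a\<close> spans \<open>V\<close>.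
\<close>

lemma dim_kernel:
  assumes V: "subspace V" "V \<subseteq> span B" "finite B" and f: "linear_form_on V f"
  shows "subspace {x \<in> V. f x = 0}" and "dim V \<le> dim {x \<in> V. f x = 0} + 1"
proof -
  let ?K = "{x \<in> V. f x = 0}"
  show "subspace ?K"
    using V(1) f linear_form_on_zero[OF f subspace_0[OF V(1)]]
    by (auto simp: subspace_def linear_form_on_def)
  show "dim V \<le> dim ?K + 1"
  proof (cases "?K = V")
    case False
    then obtain a where a: "a \<in> V" "f a \<noteq> 0" by blast
    obtain C where C: "C \<subseteq> ?K" "independent C" "?K \<subseteq> span C" "card C = dim ?K"
      using basis_exists by blast
    have fin: "finite C" using finite_dimensional_subset_card[OF V(2,3) C(2)] C(1) by blast
    have "V \<subseteq> span (insert a C)"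
    proof
      fix x assume x: "x \<in> V"
      have "x - (f x / f a) *\<^sub>R a \<in> ?K"
        using x a V(1) linear_form_on_diff_scale[OF f V(1) x a(1)]
        by (auto intro!: subspace_diff subspace_scale)
      then show "x \<in> span (insert a C)" using C(3) by (auto simp: span_insert)
    qed
    then have "dim V \<le> card (insert a C)" using fin by (intro dim_le_card) auto
    also have "\<dots> \<le> card C + 1" using fin by (simp add: card_insert_if)
    finally show ?thesis using C(4) by simp
  qed simp
qed

lemma nonzero_zero_of_one_form:
  fixes V :: "'a::real_vector set"
  assumes V: "subspace V" "V \<subseteq> span B" "finite B" "dim V \<ge> 2" and f: "linear_form_on V f"
  shows "\<exists>x\<in>V. x \<noteq> 0 \<and> f x = 0"
proof (rule ccontr)
  assume "\<not> ?thesis"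
  then have "{x \<in> V. f x = 0} \<subseteq> {0}" by blast
  then have "dim {x \<in> V. f x = 0} \<le> card ({} :: 'a set)" by (intro dim_le_card) auto
  then show False using dim_kernel(2)[OF V(1-3) f] V(4) by simp
qed

lemma nonzero_common_zero_of_two_forms:
  assumes V: "subspace V" "V \<subseteq> span B" "finite B" "dim V \<ge> 3"
    and f: "linear_form_on V f" and g: "linear_form_on V g"
  shows "\<exists>x\<in>V. x \<noteq> 0 \<and> f x = 0 \<and> g x = 0"
proof -
  let ?K = "{x \<in> V. f x = 0}"
  have "linear_form_on ?K g" by (rule linear_form_on_subset[OF g]) auto
  then have "\<exists>x\<in>?K. x \<noteq> 0 \<and> g x = 0"
    using nonzero_zero_of_one_form[of ?K B g] dim_kernel[OF V(1-3) f] V by auto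
  then show ?thesis by blast
qed

section \<open>Alternating forms of top degree\<close>

text \<open>
  Since forms are functions of whole sequences, the last clause is what gives \<open>F\<close> the degree \<open>k\<close>.
\<close>

definition alternating_form_on :: "'a::real_vector set \<Rightarrow> nat \<Rightarrow> 'a form \<Rightarrow> bool"
  where "alternating_form_on G k F \<longleftrightarrow>
    (\<forall>v j. range v \<subseteq> G \<and> j < k \<longrightarrow> linear_form_on G (\<lambda>x. F (v(j := x)))) \<and>
    (\<forall>v i j. range v \<subseteq> G \<and> i < k \<and> j < k \<and> i \<noteq> j \<and> v i = v j \<longrightarrow> F v = 0) \<and>
    (\<forall>v w. (\<forall>i<k. v i = w i) \<longrightarrow> F v = F w)"

text \<open>
  The vectors \<open>v i\<close> form a basis of \<open>G\<close>: a dependence would express some \<open>v j\<close> by the others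
  and make \<open>F v\<close> vanish. In that basis \<open>F (v(j := x))\<close> is the \<open>j\<close>-th coordinate of \<open>x\<close> times \<open>F v\<close>,
  and a nonzero vector has a nonzero coordinate.
\<close>

lemma alternating_form_on_exchange:
  assumes F: "alternating_form_on G k F" and G: "subspace G" "G \<subseteq> span B" "finite B" "dim G = k"
    and v: "range v \<subseteq> G" "F v \<noteq> 0" and x: "x \<in> G" "x \<noteq> 0"
  shows "\<exists>j<k. F (v(j := x)) \<noteq> 0"
proof (rule ccontr)
  assume "\<not> ?thesis"
  then have zero: "F (v(j := x)) = 0" if "j < k" for j using that by blast
  let ?S = "v ` {..<k}"
  have lin: "linear_form_on G (\<lambda>x. F (v(j := x)))" if "j < k" for j
    using F v that unfolding alternating_form_on_def by blast
  have rep: "F (v(j := v i)) = 0" if "j < k" "i < k" "i \<noteq> j" for i j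
  proof -
    have "range (v(j := v i)) \<subseteq> G" "(v(j := v i)) i = (v(j := v i)) j"
      using v that by auto
    then show ?thesis using F that unfolding alternating_form_on_def by blast
  qed
  have inj: "inj_on v {..<k}"
    using F v unfolding alternating_form_on_def inj_on_def by (metis lessThan_iff)
  have S: "?S \<subseteq> G" using v by auto
  have coeff: "F (v(j := \<Sum>s\<in>T. u s *\<^sub>R s)) = (if v j \<in> T then u (v j) * F v else 0)"
    if j: "j < k" and T: "T \<subseteq> ?S" for j u T
  proof -
    have fin: "finite T" using T finite_subset by blast
    have "F (v(j := \<Sum>s\<in>T. u s *\<^sub>R s)) = (\<Sum>s\<in>T. u s * F (v(j := s)))"
      using linear_form_on_sum[OF lin[OF j] G(1), of T u] T S by blast
    also have "\<dots> = (\<Sum>s\<in>T. if s = v j then u (v j) * F v else 0)"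
      by (rule sum.cong) (use T rep[OF j] in \<open>auto simp: subset_iff\<close>)
    finally show ?thesis using fin by simp
  qed
  have ind: "independent ?S"
  proof
    assume "dependent ?S"
    then obtain j where j: "j < k" "v j \<in> span (?S - {v j})"
      unfolding dependent_def by blast
    then obtain u where "v j = (\<Sum>s\<in>?S - {v j}. u s *\<^sub>R s)"
      by (auto simp: span_finite)
    with coeff[OF j(1), of "?S - {v j}" u] v show False by simp
  qed
  have "card ?S = dim G" using G(4) inj by (simp add: card_image)
  then have "x \<in> span ?S" using independent_dim_spans[OF G(2,3) ind S] x by blast
  then obtain u where u: "x = (\<Sum>s\<in>?S. u s *\<^sub>R s)" by (auto simp: span_finite)
  have "u (v j) = 0" if "j < k" for j
    using coeff[OF that order_refl, of u] zero[OF that] u v(2) that by simp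
  then have "x = 0" unfolding u by (intro sum.neutral) auto
  with x show False by simp
qed

text \<open>
  Subtracting multiples of one entry from the others does not change an alternating form, just
  as for determinants. The entries that \<open>F\<close> does not read are set to \<open>0\<close>, so that later all entries
  but the \<open>j\<close>-th can be placed in a given subspace.
\<close>

lemma alternating_form_on_project:
  assumes F: "alternating_form_on G k F" and G: "subspace G"
    and w: "range w \<subseteq> G" "j < k"
  shows "F (\<lambda>i. if i = j then w j else if i < k then w i - t i *\<^sub>R w j else 0) = F w"
proof -
  have "F (\<lambda>i. if i \<noteq> j \<and> i < l then w i - t i *\<^sub>R w j else w i) = F w" if "l \<le> k" for l
    using that
  proof (induction l)
    case (Suc l)
    let ?w = "\<lambda>i. if i \<noteq> j \<and> i < l then w i - t i *\<^sub>R w j else w i"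
    have IH: "F ?w = F w" using Suc by simp
    show ?case
    proof (cases "l = j")
      case True
      then have "(\<lambda>i. if i \<noteq> j \<and> i < Suc l then w i - t i *\<^sub>R w j else w i) = ?w"
        by (auto simp: less_Suc_eq)
      with IH show ?thesis by simp
    next
      case False
      have wG: "w i \<in> G" for i using w by auto
      have r: "range ?w \<subseteq> G"
        using wG G by (auto intro!: subspace_diff subspace_scale)
      have "linear_form_on G (\<lambda>x. F (?w(l := x)))"
        using F r Suc.prems unfolding alternating_form_on_def by (meson Suc_le_eq)
      then have "F (?w(l := w l - t l *\<^sub>R w j)) = F (?w(l := w l)) - t l * F (?w(l := w j))"
        using linear_form_on_diff_scale[OF _ G] wG by blast
      moreover have "F (?w(l := w j)) = 0"
      proof -
        have "range (?w(l := w j)) \<subseteq> G" "(?w(l := w j)) l = (?w(l := w j)) j"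
          using r wG False by auto
        then show ?thesis using F w(2) Suc.prems False
          unfolding alternating_form_on_def by (meson Suc_le_eq)
      qed
      moreover have "?w(l := w l) = ?w" by auto
      moreover have "?w(l := w l - t l *\<^sub>R w j) =
          (\<lambda>i. if i \<noteq> j \<and> i < Suc l then w i - t i *\<^sub>R w j else w i)"
        using False by (auto simp: less_Suc_eq)
      ultimately show ?thesis using IH by simp
    qed
  qed simp
  from this[of k] have "F (\<lambda>i. if i \<noteq> j \<and> i < k then w i - t i *\<^sub>R w j else w i) = F w" by simp
  moreover have "F (\<lambda>i. if i = j then w j else if i < k then w i - t i *\<^sub>R w j else 0) =
      F (\<lambda>i. if i \<noteq> j \<and> i < k then w i - t i *\<^sub>R w j else w i)"
    using F unfolding alternating_form_on_def by auto
  ultimately show ?thesis by simp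
qed

section \<open>Contact powers are alternating forms\<close>

definition bilinear_form_on :: "'a::real_vector set \<Rightarrow> ('a \<Rightarrow> 'a \<Rightarrow> real) \<Rightarrow> bool"
  where "bilinear_form_on G \<omega> \<longleftrightarrow>
    (\<forall>x\<in>G. linear_form_on G (\<omega> x)) \<and> (\<forall>y\<in>G. linear_form_on G (\<lambda>x. \<omega> x y))"

lemma pairing_linear:
  assumes "bilinear_form_on G \<omega>" "range w \<subseteq> G" "p < 2 * m"
  shows "linear_form_on G (\<lambda>x. pairing \<omega> m (w(p := x)))"
  using assms(3)
proof (induction m)
  case (Suc m)
  have wG: "w i \<in> G" for i using assms(2) by auto
  consider "p < 2 * m" | "p = 2 * m" | "p = 2 * m + 1" using Suc.prems unfolding mult_Suc_right by linarith
  then show ?case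
  proof cases
    case 1
    then show ?thesis
      using linear_form_on_mult_right[OF Suc.IH[OF 1], of "\<omega> (w (2 * m)) (w (2 * m + 1))"]
      by (simp add: pairing_Suc)
  next
    case 2
    then have "pairing \<omega> m (w(p := x)) = pairing \<omega> m w" for x
      by (intro pairing_cong) simp
    moreover have "linear_form_on G (\<lambda>x. \<omega> x (w (2 * m + 1)))"
      using assms(1) wG unfolding bilinear_form_on_def by blast
    ultimately show ?thesis
      unfolding pairing_Suc using 2
      by (simp only: fun_upd_apply linear_form_on_mult_left) (simp add: linear_form_on_mult_left)
  next
    case 3
    then have "pairing \<omega> m (w(p := x)) = pairing \<omega> m w" for x
      by (intro pairing_cong) simp
    moreover have "linear_form_on G (\<lambda>x. \<omega> (w (2 * m)) x)"
      using assms(1) wG unfolding bilinear_form_on_def by blast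
    ultimately show ?thesis
      unfolding pairing_Suc using 3
      by (simp only: fun_upd_apply linear_form_on_mult_left) (simp add: linear_form_on_mult_left)
  qed
qed simp

lemma contact_term_linear:
  assumes "bilinear_form_on G \<omega>" "linear_form_on G \<eta>" "range w \<subseteq> G" "p < 2 * m + 1"
  shows "linear_form_on G (\<lambda>x. contact_term \<omega> \<eta> m (w(p := x)))"
proof (cases "p = 2 * m")
  case True
  then have "pairing \<omega> m (w(p := x)) = pairing \<omega> m w" for x
    by (intro pairing_cong) simp
  then show ?thesis
    using True assms(2) by (simp add: contact_term_def linear_form_on_mult_left)
next
  case False
  then have "p < 2 * m" using assms(4) by simp
  then show ?thesis
    using linear_form_on_mult_right[OF pairing_linear[OF assms(1,3)]] False
    by (simp add: contact_term_def)
qed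

text \<open>
  A vector in the radical of \<open>\<omega>\<close> and the kernel of \<open>\<eta>\<close> annihilates whichever factor it is
  fed to.
\<close>

lemma contact_term_radical:
  assumes x: "\<And>y. y \<in> G \<Longrightarrow> \<omega> x y = 0 \<and> \<omega> y x = 0" "\<eta> x = 0"
    and w: "range w \<subseteq> G" "p < 2 * m + 1" "w p = x"
  shows "contact_term \<omega> \<eta> m w = 0"
proof (cases "p = 2 * m")
  case True
  then show ?thesis using assms by (simp add: contact_term_def)
next
  case False
  then have "p div 2 \<in> {..<m}" using w(2) by auto
  moreover have "\<omega> (w (2 * (p div 2))) (w (2 * (p div 2) + 1)) = 0"
  proof -
    have "w i \<in> G" for i using w(1) by auto
    moreover have "p = 2 * (p div 2) \<or> p = 2 * (p div 2) + 1" by linarith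
    ultimately show ?thesis using x(1) w(3) by metis
  qed
  ultimately have "pairing \<omega> m w = 0"
    unfolding pairing_def by (intro prod_zero) auto
  then show ?thesis by (simp add: contact_term_def)
qed

lemma contact_term_cong:
  "(\<And>i. i < 2 * m + 1 \<Longrightarrow> v i = w i) \<Longrightarrow> contact_term \<omega> \<eta> m v = contact_term \<omega> \<eta> m w"
  unfolding contact_term_def by (auto intro!: arg_cong2[of _ _ _ _ "(*)"] pairing_cong)

text \<open>
  For a repeated entry, composing all permutations with the transposition of the two indices
  changes the sign of the sum but none of its terms.
\<close>

lemma alternating_contact_sum:
  assumes "bilinear_form_on G \<omega>" "linear_form_on G \<eta>"
  shows "alternating_form_on G (2 * m + 1) (contact_sum \<omega> \<eta> m)"
  unfolding alternating_form_on_def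
proof (intro conjI allI impI; (elim conjE)?)
  fix v :: "nat \<Rightarrow> 'a" and j assume v: "range v \<subseteq> G" and j: "j < 2 * m + 1"
  show "linear_form_on G (\<lambda>x. contact_sum \<omega> \<eta> m (v(j := x)))"
    unfolding contact_sum_def
  proof (rule linear_form_on_signed_sum)
    fix \<sigma> assume s: "\<sigma> permutes {..<2 * m + 1}"
    have "v(j := x) \<circ> \<sigma> = (v \<circ> \<sigma>)(inv \<sigma> j := x)" for x
      using permutes_inverses[OF s] by (auto simp: fun_eq_iff)
    moreover have "inv \<sigma> j < 2 * m + 1"
      using permutes_in_image[OF permutes_inv[OF s], of j] j by simp
    moreover have "range (v \<circ> \<sigma>) \<subseteq> G" using v by auto
    ultimately show "linear_form_on G (\<lambda>x. contact_term \<omega> \<eta> m (v(j := x) \<circ> \<sigma>))"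
      using contact_term_linear[OF assms] by simp
  qed
next
  fix v :: "nat \<Rightarrow> 'a" and i j
  assume ij: "i < 2 * m + 1" "j < 2 * m + 1" "i \<noteq> j" "v i = v j"
  let ?t = "transpose i j"
  let ?P = "{\<sigma>. \<sigma> permutes {..<2 * m + 1}}"
  have t: "?t permutes {..<2 * m + 1}" using ij by (intro permutes_swap_id) auto
  have vt: "v \<circ> (?t \<circ> \<sigma>) = v \<circ> \<sigma>" for \<sigma>
    using ij by (auto simp: transpose_def fun_eq_iff)
  have "contact_sum \<omega> \<eta> m v =
      (\<Sum>\<sigma>\<in>?P. of_int (sign (?t \<circ> \<sigma>)) * contact_term \<omega> \<eta> m (v \<circ> (?t \<circ> \<sigma>)))"
    unfolding contact_sum_def signed_sum_def by (rule setum_permutations_compose_left[OF t])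
  also have "\<dots> = (\<Sum>\<sigma>\<in>?P. - (of_int (sign \<sigma>) * contact_term \<omega> \<eta> m (v \<circ> \<sigma>)))"
    by (rule sum.cong)
      (use t ij(3) in \<open>auto simp: sign_compose permutes_imp_permutation[OF finite_lessThan]
        sign_swap_id vt\<close>)
  also have "\<dots> = - contact_sum \<omega> \<eta> m v"
    unfolding contact_sum_def signed_sum_def by (simp add: sum_negf)
  finally show "contact_sum \<omega> \<eta> m v = 0" by simp
next
  fix v w :: "nat \<Rightarrow> 'a" assume eq: "\<forall>i<2 * m + 1. v i = w i"
  show "contact_sum \<omega> \<eta> m v = contact_sum \<omega> \<eta> m w"
    unfolding contact_sum_def
  proof (intro signed_sum_cong contact_term_cong)
    fix \<sigma> i assume "\<sigma> permutes {..<2 * m + 1}" "i < 2 * m + 1"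
    then have "\<sigma> i < 2 * m + 1" using permutes_in_image by (metis lessThan_iff)
    then show "(v \<circ> \<sigma>) i = (w \<circ> \<sigma>) i" using eq by simp
  qed
qed

section \<open>Restriction to a hyperplane\<close>

text \<open>
  Exchanging the pair in positions \<open>0, 1\<close> with the pair in positions \<open>2 i, 2 i + 1\<close> only
  permutes the factors. Composing with it moves position \<open>0\<close> to any even position.
\<close>

lemma pairing_swap_pairs:
  assumes "i < m"
  shows "pairing \<omega> m (w \<circ> (transpose 0 (2 * i) \<circ> transpose 1 (2 * i + 1))) = pairing \<omega> m w"
proof -
  let ?\<pi> = "transpose 0 (2 * i) \<circ> transpose 1 (2 * i + 1)"
  have "transpose 0 i permutes {..<m}" using assms by (intro permutes_swap_id) auto
  from prod.permute[OF this, of "\<lambda>l. \<omega> (w (2 * l)) (w (2 * l + 1))"]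
  have "pairing \<omega> m w =
      (\<Prod>l<m. \<omega> (w (2 * transpose 0 i l)) (w (2 * transpose 0 i l + 1)))"
    by (simp add: pairing_def o_def)
  moreover have "?\<pi> (2 * l) = 2 * transpose 0 i l" for l
    by (auto simp: transpose_def; presburger)
  moreover have "?\<pi> (2 * l + 1) = 2 * transpose 0 i l + 1" for l
    by (auto simp: transpose_def; presburger)
  ultimately show ?thesis by (simp add: pairing_def)
qed

lemma pairing_flip_pair:
  assumes "i < m" "\<omega> (w (2 * i + 1)) (w (2 * i)) = - \<omega> (w (2 * i)) (w (2 * i + 1))"
  shows "pairing \<omega> m (w \<circ> transpose (2 * i) (2 * i + 1)) = - pairing \<omega> m w"
proof -
  let ?w = "w \<circ> transpose (2 * i) (2 * i + 1)"
  have eq: "?w (2 * l) = w (2 * l)" "?w (2 * l + 1) = w (2 * l + 1)" if "l \<noteq> i" for l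
    using that by (auto simp: transpose_def; presburger)+
  have "(\<Prod>l\<in>{..<m} - {i}. \<omega> (?w (2 * l)) (?w (2 * l + 1))) =
      (\<Prod>l\<in>{..<m} - {i}. \<omega> (w (2 * l)) (w (2 * l + 1)))"
    by (rule prod.cong[OF refl]) (use eq in auto)
  then show ?thesis
    using assms by (simp add: pairing_def prod.remove[of "{..<m}" i])
qed

text \<open>
  This is the contraction formula
  \<open>i\<^sub>e (\<omega>\<^sup>m\<^sup>+\<^sup>1 \<and> \<eta>) = (m + 1) i\<^sub>e \<omega> \<and> \<omega>\<^sup>m \<and> \<eta>\<close> for \<open>\<eta> e = 0\<close>, with \<open>e = v j\<close>: every summand on the
  right evaluates \<open>\<omega>\<^sup>m \<and> \<eta>\<close> on the remaining vectors, all of which lie in \<open>N\<close>. In the signed sum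
  the permutations are sorted by the position \<open>p\<close> that receives \<open>e\<close>. All positions within the pairs
  contribute the same up to sign, so only \<open>p = 0\<close> needs the hypothesis on \<open>N\<close>.
\<close>

lemma contact_sum_zero_reduction:
  assumes antisym: "\<And>x y. x \<in> G \<Longrightarrow> y \<in> G \<Longrightarrow> \<omega> y x = - \<omega> x y"
    and v: "range v \<subseteq> G" "\<And>i. i \<noteq> j \<Longrightarrow> v i \<in> N" "j < 2 * Suc m + 1" "\<eta> (v j) = 0"
    and zero: "\<And>u. range u \<subseteq> N \<Longrightarrow> contact_sum \<omega> \<eta> m u = 0"
  shows "contact_sum \<omega> \<eta> (Suc m) v = 0"
proof -
  define k where "k = 2 * Suc m + 1"
  define c where "c \<sigma> = contact_term \<omega> \<eta> (Suc m) (v \<circ> \<sigma>)" for \<sigma>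
  define g where "g p \<sigma> = (if \<sigma> p = j then c \<sigma> else 0)" for p and \<sigma> :: "nat \<Rightarrow> nat"
  have vG: "v i \<in> G" for i using v(1) by auto
  have "contact_sum \<omega> \<eta> (Suc m) v = signed_sum k (\<lambda>\<sigma>. \<Sum>p<k. g p \<sigma>)"
    unfolding contact_sum_def k_def[symmetric] c_def[symmetric]
  proof (rule signed_sum_cong)
    fix \<sigma> assume s: "\<sigma> permutes {..<k}"
    have "inv \<sigma> j < k"
      using permutes_in_image[OF permutes_inv[OF s], of j] v(3) by (simp add: k_def)
    moreover have "(\<Sum>p<k. g p \<sigma>) = (\<Sum>p<k. if p = inv \<sigma> j then c \<sigma> else 0)"
      by (rule sum.cong) (use permutes_inverses[OF s] in \<open>auto simp: g_def\<close>)
    ultimately show "c \<sigma> = (\<Sum>p<k. g p \<sigma>)" by simp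
  qed
  then have split: "contact_sum \<omega> \<eta> (Suc m) v = (\<Sum>p<k. signed_sum k (g p))"
    by (simp add: signed_sum_sum)
  \<comment> \<open>Averaging over the permutations of the positions after the first pair turns the product of the
    remaining factors into the contact sum of degree \<open>2 m + 1\<close> on vectors of \<open>N\<close>.\<close>
  have front: "signed_sum k (g 0) = 0"
  proof -
    have "signed_sum (2 * m + 1) (\<lambda>\<tau>. g 0 (\<sigma> \<circ> shift_permutation 2 (2 * m + 1) \<tau>)) = 0"
      if s: "\<sigma> permutes {..<k}" for \<sigma>
    proof (cases "\<sigma> 0 = j")
      case True
      let ?u = "\<lambda>i. v (\<sigma> (2 + i))"
      have "g 0 (\<sigma> \<circ> shift_permutation 2 (2 * m + 1) \<tau>) =
          \<omega> (v (\<sigma> 0)) (v (\<sigma> 1)) * contact_term \<omega> \<eta> m (?u \<circ> \<tau>)"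
        if t: "\<tau> permutes {..<2 * m + 1}" for \<tau>
      proof -
        let ?h = "shift_permutation 2 (2 * m + 1) \<tau>"
        have h: "?h 0 = 0" "?h 1 = 1" "i < 2 * m + 1 \<Longrightarrow> ?h (2 + i) = 2 + \<tau> i" for i
          using shift_permutation(3,4)[OF t, of _ 2] by auto
        have "pairing \<omega> m (\<lambda>i. v (\<sigma> (?h (2 + i)))) = pairing \<omega> m (?u \<circ> \<tau>)"
          by (rule pairing_cong) (simp only: h(3) o_def trans_less_add1)
        then show ?thesis
          unfolding g_def c_def contact_term_def pairing_Suc_front
          using h(1,2) h(3)[of "2 * m"] True by (simp add: o_def)
      qed
      then have "signed_sum (2 * m + 1) (\<lambda>\<tau>. g 0 (\<sigma> \<circ> shift_permutation 2 (2 * m + 1) \<tau>)) =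
          \<omega> (v (\<sigma> 0)) (v (\<sigma> 1)) * contact_sum \<omega> \<eta> m ?u"
        unfolding contact_sum_def signed_sum_scale[symmetric] by (rule signed_sum_cong)
      moreover have "range ?u \<subseteq> N"
      proof -
        have "\<sigma> (2 + i) \<noteq> j" for i
          using True permutes_inj[OF s] by (metis add_is_0 injD zero_neq_numeral)
        then show ?thesis using v(2) by auto
      qed
      ultimately show ?thesis using zero by simp
    next
      case False
      have "g 0 (\<sigma> \<circ> shift_permutation 2 (2 * m + 1) \<tau>) = 0"
        if t: "\<tau> permutes {..<2 * m + 1}" for \<tau>
        using False shift_permutation(4)[OF t, of 0 2] by (simp add: g_def)
      then show ?thesis by (rule signed_sum_zero)
    qed
    then have "signed_sum k (\<lambda>\<sigma>. signed_sum (2 * m + 1)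
        (\<lambda>\<tau>. g 0 (\<sigma> \<circ> shift_permutation 2 (2 * m + 1) \<tau>))) = 0"
      by (rule signed_sum_zero)
    then have "fact (2 * m + 1) * signed_sum k (g 0) = 0"
      by (subst (asm) signed_sum_average_shift) (simp_all add: k_def)
    then show ?thesis by (metis fact_nonzero mult_eq_0_iff)
  qed
  have even: "signed_sum k (g (2 * i)) = 0" if i: "i < Suc m" for i
  proof -
    let ?\<pi> = "transpose 0 (2 * i) \<circ> transpose 1 (2 * i + 1)"
    have p: "?\<pi> permutes {..<k}"
      using i by (intro permutes_compose permutes_swap_id) (auto simp: k_def)
    have "?\<pi> 0 = 2 * i" "?\<pi> (2 * Suc m) = 2 * Suc m"
      using i by (auto simp: transpose_def)
    then have "g 0 (\<sigma> \<circ> ?\<pi>) = g (2 * i) \<sigma>" for \<sigma>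
      using pairing_swap_pairs[OF i, of \<omega> "v \<circ> \<sigma>"]
      by (simp add: g_def c_def contact_term_def o_assoc del: mult_Suc_right)
    then have "signed_sum k (g (2 * i)) = of_int (sign ?\<pi>) * signed_sum k (g 0)"
      using signed_sum_compose[OF p, of "g 0"] by simp
    then show ?thesis using front by simp
  qed
  have odd: "signed_sum k (g (2 * i + 1)) = 0" if i: "i < Suc m" for i
  proof -
    let ?\<pi> = "transpose (2 * i) (2 * i + 1)"
    have p: "?\<pi> permutes {..<k}"
      using i by (intro permutes_swap_id) (auto simp: k_def)
    have "?\<pi> (2 * i) = 2 * i + 1" "?\<pi> (2 * Suc m) = 2 * Suc m"
      using i by (auto simp: transpose_def)
    moreover have "pairing \<omega> (Suc m) (v \<circ> \<sigma> \<circ> ?\<pi>) = - pairing \<omega> (Suc m) (v \<circ> \<sigma>)" for \<sigma>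
      by (rule pairing_flip_pair[OF i]) (unfold o_apply, rule antisym[OF vG vG])
    ultimately have "g (2 * i) (\<sigma> \<circ> ?\<pi>) = (-1) * g (2 * i + 1) \<sigma>" for \<sigma>
      by (simp add: g_def c_def contact_term_def o_assoc del: mult_Suc_right)
    then have "(-1) * signed_sum k (g (2 * i + 1)) = of_int (sign ?\<pi>) * signed_sum k (g (2 * i))"
      using signed_sum_compose[OF p, of "g (2 * i)"] signed_sum_scale[of k "-1"] by simp
    then show ?thesis using even[OF i] by simp
  qed
  \<comment> \<open>The last position is the argument of \<open>\<eta>\<close>, which vanishes on \<open>v j\<close>.\<close>
  have last: "signed_sum k (g (2 * Suc m)) = 0"
    by (rule signed_sum_zero) (use v(4) in \<open>auto simp: g_def c_def contact_term_def\<close>)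
  have "signed_sum k (g p) = 0" if "p < k" for p
  proof (cases "p = 2 * Suc m")
    case False
    then have i: "p div 2 < Suc m" using that by (simp add: k_def)
    have "p = 2 * (p div 2) \<or> p = 2 * (p div 2) + 1" by linarith
    then show ?thesis using even[OF i] odd[OF i] by metis
  qed (use last in simp)
  then show ?thesis using split by simp
qed

text \<open>
  Exchange \<open>e\<close> into a tuple on which \<open>\<omega>\<^sup>m\<^sup>+\<^sup>1 \<and> \<eta>\<close> is nonzero, and project its other entries
  along \<open>e\<close> into \<open>N\<close>: the value stays nonzero, so by the contraction argument \<open>\<omega>\<^sup>m \<and> \<eta>\<close> cannot
  vanish on \<open>N\<close>.
\<close>

lemma contact_sum_nonzero_on_hyperplane:
  assumes G: "subspace G" "G \<subseteq> span B" "finite B" "dim G = 2 * Suc m + 1"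
    and form: "bilinear_form_on G \<omega>" "linear_form_on G \<eta>"
    and antisym: "\<And>x y. x \<in> G \<Longrightarrow> y \<in> G \<Longrightarrow> \<omega> y x = - \<omega> x y"
    and N: "subspace N" "N \<subseteq> G"
    and e: "e \<in> G" "e \<noteq> 0" "\<eta> e = 0" "\<And>y. y \<in> G \<Longrightarrow> \<exists>t. y - t *\<^sub>R e \<in> N"
    and v: "range v \<subseteq> G" "contact_sum \<omega> \<eta> (Suc m) v \<noteq> 0"
  shows "nonzero_form_on N (contact_sum \<omega> \<eta> m)"
proof (rule ccontr)
  assume n: "\<not> ?thesis"
  let ?F = "contact_sum \<omega> \<eta> (Suc m)"
  have F: "alternating_form_on G (2 * Suc m + 1) ?F"
    by (rule alternating_contact_sum[OF form])
  obtain j where j: "j < 2 * Suc m + 1" "?F (v(j := e)) \<noteq> 0"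
    using alternating_form_on_exchange[OF F G v e(1,2)] by blast
  let ?w = "v(j := e)"
  have w: "range ?w \<subseteq> G" using v e by auto
  then have wG: "?w i \<in> G" for i by blast
  obtain t where t: "\<And>i. ?w i - t i *\<^sub>R e \<in> N"
    using e(4)[OF wG] by metis
  define u where "u i = (if i = j then ?w j else if i < 2 * Suc m + 1
    then ?w i - t i *\<^sub>R ?w j else 0)" for i
  have "?F u = ?F ?w"
    unfolding u_def by (rule alternating_form_on_project[OF F G(1) w j(1)])
  moreover have "?F u = 0"
  proof (rule contact_sum_zero_reduction[OF antisym])
    show "u i \<in> N" if "i \<noteq> j" for i
      using that t[of i] subspace_0[OF N(1)] by (auto simp: u_def)
    moreover have "u j = e" by (simp add: u_def)
    ultimately show "range u \<subseteq> G" using N(2) e(1) by (metis image_subsetI subsetD)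
    show "\<eta> (u j) = 0" using e(3) by (simp add: u_def)
    show "contact_sum \<omega> \<eta> m x = 0" if "range x \<subseteq> N" for x
      using n that unfolding nonzero_form_on_def by blast
  qed (use j in auto)
  ultimately show False using j by simp
qed

section \<open>Contact and exact symplectic forms on Lie algebras\<close>

context lie_algebra
begin

lemma bracket_antisym:
  assumes "x \<in> G" "y \<in> G"
  shows "br y x = - br x y"
proof -
  have "x + y \<in> G" using assms subspace_carrier subspace_add by blast
  then have "0 = br x (x + y) + br y (x + y)"
    using assms by (metis bracket_add_left bracket_alternating)
  also have "\<dots> = br x y + br y x"
    using assms by (simp add: bracket_add_right bracket_alternating)
  finally have "br x y + br y x = 0" by simp
  then show ?thesis by (metis add.inverse_unique)
qed

lemma zero_in_carrier: "0 \<in> G"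
  using subspace_carrier by (rule subspace_0)

lemma bracket_zero_left: "y \<in> G \<Longrightarrow> br 0 y = 0"
  using bracket_scale_left[of 0 y 0] zero_in_carrier by simp

lemma bilinear_lie_d:
  assumes "linear_form_on G \<eta>"
  shows "bilinear_form_on G (lie_d br \<eta>)"
  using assms bracket_closed
  by (auto simp: bilinear_form_on_def linear_form_on_def lie_d_def bracket_add_left
      bracket_add_right bracket_scale_left bracket_scale_right)

lemma lie_d_antisym:
  assumes "linear_form_on G \<eta>" "x \<in> G" "y \<in> G"
  shows "lie_d br \<eta> y x = - lie_d br \<eta> x y"
  using bracket_antisym[OF assms(2,3)] linear_form_on_neg[OF assms(1)] bracket_closed assms(2,3)
  by (simp add: lie_d_def)

lemma linear_form_bracket:
  assumes "linear_form_on G \<eta>" "y \<in> G"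
  shows "linear_form_on G (\<lambda>x. \<eta> (br x y))"
  using assms bracket_closed
  by (auto simp: linear_form_on_def bracket_add_left bracket_scale_left)

text \<open>
  The nondegeneracy of a contact form that all obstructions below contradict. A nonzero \<open>x\<close>
  violating it could be exchanged into a tuple with \<open>(\<partial>\<eta>)\<^sup>n \<and> \<eta> \<noteq> 0\<close>, but every term of that form
  vanishes when it is fed \<open>x\<close>.
\<close>

lemma contact_form_radical:
  assumes c: "contact_form G br \<eta>" and x: "x \<in> G" "\<eta> x = 0" "\<And>y. y \<in> G \<Longrightarrow> \<eta> (br x y) = 0"
  shows "x = 0"
proof (rule ccontr)
  assume x0: "x \<noteq> 0"
  let ?\<omega> = "lie_d br \<eta>"
  obtain n v where lin: "linear_form_on G \<eta>" and n: "dim G = 2 * n + 1"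
    and v: "range v \<subseteq> G" "contact_sum ?\<omega> \<eta> n v \<noteq> 0"
    using c by (auto simp: contact_form_def nonzero_form_on_def contact_power_eq_contact_sum)
  obtain B where B: "finite B" "G \<subseteq> span B" using finite_dimensional by blast
  obtain j where j: "j < 2 * n + 1" "contact_sum ?\<omega> \<eta> n (v(j := x)) \<noteq> 0"
    using alternating_form_on_exchange[OF alternating_contact_sum[OF bilinear_lie_d[OF lin] lin]
        subspace_carrier B(2,1) n v x(1) x0] by blast
  have rad: "?\<omega> x y = 0 \<and> ?\<omega> y x = 0" if "y \<in> G" for y
    using x that lie_d_antisym[OF lin x(1) that] by (simp add: lie_d_def)
  have "contact_sum ?\<omega> \<eta> n (v(j := x)) = 0"
    unfolding contact_sum_def
  proof (rule signed_sum_zero)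
    fix \<sigma> assume s: "\<sigma> permutes {..<2 * n + 1}"
    show "contact_term ?\<omega> \<eta> n (v(j := x) \<circ> \<sigma>) = 0"
    proof (rule contact_term_radical)
      show "?\<omega> x y = 0 \<and> ?\<omega> y x = 0" if "y \<in> G" for y by (rule rad[OF that])
      show "\<eta> x = 0" by (rule x(2))
      show "range (v(j := x) \<circ> \<sigma>) \<subseteq> G" using v x by auto
      show "inv \<sigma> j < 2 * n + 1"
        using permutes_in_image[OF permutes_inv[OF s], of j] j by simp
      show "(v(j := x) \<circ> \<sigma>) (inv \<sigma> j) = x" using permutes_inverses[OF s] by simp
    qed
  qed
  then show False using j by blast
qed

lemma derived_ideal_carrier:
  shows "subspace (derived_ideal G br)" and "derived_ideal G br \<subseteq> G"
    and "x \<in> G \<Longrightarrow> y \<in> G \<Longrightarrow> br x y \<in> derived_ideal G br"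
proof -
  show "derived_ideal G br \<subseteq> G"
    unfolding derived_ideal_def by (rule span_minimal[OF _ subspace_carrier]) (use bracket_closed in auto)
  show "subspace (derived_ideal G br)" by (simp add: derived_ideal_def)
  show "br x y \<in> derived_ideal G br" if "x \<in> G" "y \<in> G"
    unfolding derived_ideal_def by (rule span_base) (use that in blast)
qed

lemma subspace_lie_center:
  assumes "subspace H" "H \<subseteq> G"
  shows "subspace (lie_center H br)"
  unfolding subspace_def
proof (intro conjI ballI allI)
  show "0 \<in> lie_center H br"
    using assms subspace_0[OF assms(1)] bracket_zero_left by (auto simp: lie_center_def)
  show "x + y \<in> lie_center H br" if "x \<in> lie_center H br" "y \<in> lie_center H br" for x y
    using that assms by (auto simp: lie_center_def subset_iff bracket_add_left subspace_add)
  show "c *\<^sub>R x \<in> lie_center H br" if "x \<in> lie_center H br" for c x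
    using that assms by (auto simp: lie_center_def subset_iff bracket_scale_left subspace_scale)
qed

text \<open>
  Since \<open>G = H + \<real> e\<close>, for an element centralising \<open>H\<close> membership in the radical of \<open>\<partial>\<eta>\<close> is one
  linear condition.
\<close>

lemma radical_from_complement:
  assumes \<eta>: "linear_form_on G \<eta>" and H: "H \<subseteq> G" "\<And>z. z \<in> H \<Longrightarrow> br x z = 0"
    and e: "e \<in> G" "\<And>y. y \<in> G \<Longrightarrow> \<exists>t. y - t *\<^sub>R e \<in> H"
    and x: "x \<in> G" "\<eta> (br x e) = 0" and y: "y \<in> G"
  shows "\<eta> (br x y) = 0"
proof -
  obtain t where t: "y - t *\<^sub>R e \<in> H" using e y by blast
  have te: "t *\<^sub>R e \<in> G" using e subspace_carrier subspace_scale by blast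
  have "br x ((y - t *\<^sub>R e) + t *\<^sub>R e) = br x (y - t *\<^sub>R e) + br x (t *\<^sub>R e)"
    using t H(1) x(1) te by (intro bracket_add_right) auto
  also have "\<dots> = t *\<^sub>R br x e" using H(2)[OF t] x e by (simp add: bracket_scale_right)
  finally have "br x y = t *\<^sub>R br x e" by simp
  then show ?thesis
    using \<eta> x e bracket_closed unfolding linear_form_on_def by simp
qed

lemma contact_center_zero:
  assumes c: "contact_form G br \<eta>" and H: "subspace H" "H \<subseteq> G"
    and e: "e \<in> G" "\<And>y. y \<in> G \<Longrightarrow> \<exists>t. y - t *\<^sub>R e \<in> H"
    and x: "x \<in> lie_center H br" "\<eta> x = 0" "\<eta> (br x e) = 0"
  shows "x = 0"
proof -
  have \<eta>: "linear_form_on G \<eta>" using c by (simp add: contact_form_def)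
  have xG: "x \<in> G" using x H by (auto simp: lie_center_def)
  show ?thesis
  proof (rule contact_form_radical[OF c xG x(2)])
    show "\<eta> (br x y) = 0" if "y \<in> G" for y
      by (rule radical_from_complement[OF \<eta> H(2) _ e xG x(3) that])
        (use x(1) in \<open>simp_all add: lie_center_def\<close>)
  qed
qed

text \<open>
  On the center of \<open>H\<close> the two linear forms \<open>\<eta>\<close> and \<open>x \<mapsto> \<eta> [x, e]\<close> have no common nonzero
  zero, so its dimension is at most \<open>2\<close>. If the complement \<open>e\<close> acted on a two-dimensional center by
  a scalar, the second form would be a multiple of the first, and a single form on a plane has a
  nonzero zero.
\<close>

lemma contact_center_hyperplane:
  assumes c: "contact_form G br \<eta>" and H: "subspace H" "H \<subseteq> G" "dim H + 1 = dim G"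
  shows "dim (lie_center H br) \<le> 2"
    and "dim (lie_center H br) = 2 \<Longrightarrow>
      \<exists>e \<in> G. \<not> (\<exists>c::real. \<forall>x \<in> lie_center H br. br e x = c *\<^sub>R x)"
proof -
  let ?Z = "lie_center H br"
  obtain B where B: "finite B" "G \<subseteq> span B" using finite_dimensional by blast
  note compl = hyperplane_complement[OF subspace_carrier B(2,1) H]
  obtain e where e: "e \<in> G" "e \<notin> H" using compl(1) by blast
  have zero: "x = 0" if "x \<in> ?Z" "\<eta> x = 0" "\<eta> (br x e) = 0" for x
    by (rule contact_center_zero[OF c H(1,2) e(1) compl(2)[OF e] that])
  have \<eta>: "linear_form_on G \<eta>" using c by (simp add: contact_form_def)
  have Z: "?Z \<subseteq> G" using H(2) by (auto simp: lie_center_def)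
  then have ZB: "?Z \<subseteq> span B" using B(2) by blast
  note Zsub = subspace_lie_center[OF H(1,2)]
  note restrict = linear_form_on_subset[OF _ Z]
  show "dim ?Z \<le> 2"
  proof (rule ccontr)
    assume "\<not> ?thesis"
    then have "\<exists>x\<in>?Z. x \<noteq> 0 \<and> \<eta> x = 0 \<and> \<eta> (br x e) = 0"
      by (intro nonzero_common_zero_of_two_forms[OF Zsub ZB B(1)] restrict \<eta> linear_form_bracket[OF \<eta> e(1)]) simp
    with zero show False by blast
  qed
  assume "dim ?Z = 2"
  then obtain x where x: "x \<in> ?Z" "x \<noteq> 0" "\<eta> x = 0"
    using nonzero_zero_of_one_form[OF Zsub ZB B(1) _ restrict[OF \<eta>]] by auto
  have xG: "x \<in> G" using x Z by blast
  show "\<exists>e \<in> G. \<not> (\<exists>c::real. \<forall>x \<in> ?Z. br e x = c *\<^sub>R x)"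
  proof (rule bexI[OF notI e(1)])
    assume "\<exists>c::real. \<forall>x \<in> ?Z. br e x = c *\<^sub>R x"
    then obtain c :: real where "br e x = c *\<^sub>R x" using x by blast
    then have "br x e = (- c) *\<^sub>R x" using bracket_antisym[OF e(1) xG] by simp
    moreover have "\<eta> ((- c) *\<^sub>R x) = - c * \<eta> x"
      using \<eta> xG unfolding linear_form_on_def by blast
    ultimately have "\<eta> (br x e) = 0" using x by simp
    with zero x show False by blast
  qed
qed

text \<open>
  The restriction of \<open>\<eta>\<close> itself works. The contraction argument needs a vector of \<open>ker \<eta>\<close> outside
  \<open>N = [G, G]\<close>. If there were none, the hyperplanes \<open>ker \<eta>\<close> and \<open>N\<close> would coincide, so \<open>\<eta>\<close> would vanish
  on all brackets and \<open>\<partial>\<eta> = 0\<close>, which is impossible for a contact form when \<open>dim G \<ge> 3\<close>.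
\<close>

lemma contact_form_derived_ideal:
  assumes c: "contact_form G br \<eta>" and dim: "dim G = 2 * Suc m + 1"
    and N: "dim (derived_ideal G br) + 1 = dim G"
  shows "nonzero_form_on (derived_ideal G br) (contact_power br m \<eta>)"
proof -
  let ?N = "derived_ideal G br" and ?\<omega> = "lie_d br \<eta>"
  obtain B where B: "finite B" "G \<subseteq> span B" using finite_dimensional by blast
  note compl = hyperplane_complement[OF subspace_carrier B(2,1) derived_ideal_carrier(1,2) N]
  have \<eta>: "linear_form_on G \<eta>" using c by (simp add: contact_form_def)
  have "\<exists>e\<in>G. e \<notin> ?N \<and> \<eta> e = 0"
  proof (rule ccontr)
    assume "\<not> ?thesis"
    then have ker: "e \<in> ?N" if "e \<in> G" "\<eta> e = 0" for e using that by blast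
    obtain a where a: "a \<in> G" "a \<notin> ?N" using compl(1) by blast
    then have \<eta>a: "\<eta> a \<noteq> 0" using ker by blast
    \<comment> \<open>Otherwise \<open>a\<close> could be moved along \<open>y\<close> into \<open>ker \<eta>\<close> and hence into \<open>N\<close>, although \<open>y\<close> is in \<open>N\<close>.\<close>
    have vanish: "\<eta> y = 0" if y: "y \<in> ?N" for y
    proof (rule ccontr)
      assume ny: "\<eta> y \<noteq> 0"
      have yG: "y \<in> G" using y derived_ideal_carrier(2) by blast
      let ?z = "a - (\<eta> a / \<eta> y) *\<^sub>R y"
      have "?z \<in> G" using a yG subspace_carrier by (intro subspace_diff subspace_scale)
      moreover have "\<eta> ?z = 0"
        using linear_form_on_diff_scale[OF \<eta> subspace_carrier a(1) yG] ny by simp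
      ultimately have "?z \<in> ?N" by (rule ker)
      then have "?z + (\<eta> a / \<eta> y) *\<^sub>R y \<in> ?N"
        using y derived_ideal_carrier(1) by (intro subspace_add subspace_scale)
      with a show False by simp
    qed
    have "dim ?N \<ge> 2" using N dim by simp
    then obtain x where x: "x \<in> ?N" "x \<noteq> 0"
      using nonzero_zero_of_one_form[OF derived_ideal_carrier(1) order_trans[OF derived_ideal_carrier(2) B(2)] B(1)
          _ linear_form_on_subset[OF \<eta> derived_ideal_carrier(2)]] by blast
    then have "x \<in> G" using derived_ideal_carrier(2) by blast
    then have "x = 0"
      using vanish x(1) derived_ideal_carrier(3) by (intro contact_form_radical[OF c]) auto
    with x show False by simp
  qed
  then obtain e where e: "e \<in> G" "e \<notin> ?N" "\<eta> e = 0" by blast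
  then have "e \<noteq> 0" using subspace_0[OF derived_ideal_carrier(1)] by blast
  obtain v where v: "range v \<subseteq> G" "contact_sum ?\<omega> \<eta> (Suc m) v \<noteq> 0"
  proof -
    obtain n v where n: "dim G = 2 * n + 1" "range v \<subseteq> G" "contact_sum ?\<omega> \<eta> n v \<noteq> 0"
      using c by (auto simp: contact_form_def nonzero_form_on_def contact_power_eq_contact_sum)
    moreover have "n = Suc m" using n(1) dim by simp
    ultimately show ?thesis using that by blast
  qed
  have "nonzero_form_on ?N (contact_sum ?\<omega> \<eta> m)"
    by (rule contact_sum_nonzero_on_hyperplane[OF subspace_carrier B(2,1) dim bilinear_lie_d[OF \<eta>] \<eta>
          lie_d_antisym[OF \<eta>] derived_ideal_carrier(1,2) e(1) \<open>e \<noteq> 0\<close> e(3) compl(2)[OF e(1,2)] v])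
  then show ?thesis
    by (simp add: nonzero_form_on_def contact_power_eq_contact_sum)
qed

text \<open>
  An abelian hyperplane \<open>A\<close> is its own center, and \<open>dim A \<ge> 3\<close> exceeds the bound that a contact
  form imposes. For an exact symplectic form \<open>\<partial>\<alpha>\<close>, the single form \<open>x \<mapsto> \<alpha> [x, e]\<close> already has a nonzero
  zero on \<open>A\<close>, and it lies in the radical of \<open>\<partial>\<alpha>\<close>.
\<close>

lemma abelian_hyperplane_obstruction:
  assumes A: "lie_subalgebra A G br" "abelian_on A br" "dim A + 1 = dim G" "dim G \<ge> 4"
  shows "\<not> contact_form G br \<eta>" and "\<not> exact_symplectic_form G br \<omega>"
proof -
  have sub: "subspace A" "A \<subseteq> G" using A(1) by (auto simp: lie_subalgebra_def)
  obtain B where B: "finite B" "G \<subseteq> span B" using finite_dimensional by blast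
  have AB: "A \<subseteq> span B" using sub B by blast
  note compl = hyperplane_complement[OF subspace_carrier B(2,1) sub A(3)]
  have center: "lie_center A br = A" using A(2) by (auto simp: lie_center_def abelian_on_def)
  show "\<not> contact_form G br \<eta>"
    using contact_center_hyperplane(1)[OF _ sub A(3)] A(3,4) center by auto
  show "\<not> exact_symplectic_form G br \<omega>"
  proof
    assume "exact_symplectic_form G br \<omega>"
    then obtain \<alpha> where nd: "nondegenerate_on G \<omega>" and \<alpha>: "linear_form_on G \<alpha>"
      and \<omega>: "\<And>x y. x \<in> G \<Longrightarrow> y \<in> G \<Longrightarrow> \<omega> x y = lie_d br \<alpha> x y"
      unfolding exact_symplectic_form_def by blast
    obtain e where e: "e \<in> G" "e \<notin> A" using compl(1) by blast
    have "dim A \<ge> 2" using A(3,4) by simp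
    then obtain x where x: "x \<in> A" "x \<noteq> 0" "\<alpha> (br x e) = 0"
      using nonzero_zero_of_one_form[OF sub(1) AB B(1) _
          linear_form_on_subset[OF linear_form_bracket[OF \<alpha> e(1)] sub(2)]] by blast
    then have xG: "x \<in> G" using sub by blast
    have "\<omega> x y = 0" if y: "y \<in> G" for y
    proof -
      have "\<alpha> (br x y) = 0"
        by (rule radical_from_complement[OF \<alpha> sub(2) _ e(1) compl(2)[OF e] xG x(3) y])
          (use A(2) x(1) in \<open>auto simp: abelian_on_def\<close>)
      then show ?thesis using \<omega>[OF xG y] by (simp add: lie_d_def)
    qed
    with nd xG x(2) show False unfolding nondegenerate_on_def by blast
  qed
qed

end

theorem proposition3:
  fixes G :: "'a::real_vector set" and br :: "'a \<Rightarrow> 'a \<Rightarrow> 'a"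
  assumes "lie_algebra G br"
  shows "(\<forall>n N. n \<ge> 1 \<and> dim G = 2 * n + 1 \<and> solvable_lie_algebra G br \<and>
            (\<exists>\<eta>. contact_form G br \<eta>) \<and>
            N = derived_ideal G br \<and> dim N + 1 = dim G \<longrightarrow>
            dim (lie_center N br) \<le> 2 \<and>
            (dim (lie_center N br) = 2 \<longrightarrow>
              (\<exists>e \<in> G. \<not> (\<exists>c::real. \<forall>x \<in> lie_center N br. br e x = c *\<^sub>R x))) \<and>
            (\<exists>\<alpha>. linear_form_on N \<alpha> \<and> nonzero_form_on N (contact_power br (n - 1) \<alpha>)))
       \<and> ((\<exists>A. lie_subalgebra A G br \<and> abelian_on A br \<and> dim A + 1 = dim G) \<and> dim G \<ge> 4 \<longrightarrow>
            \<not> (\<exists>\<eta>. contact_form G br \<eta>) \<and> \<not> (\<exists>\<omega>. exact_symplectic_form G br \<omega>))"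
proof (intro conjI allI impI; (elim conjE exE)?)
  interpret lie_algebra G br by fact
  fix n N \<eta>
  assume n: "n \<ge> 1" "dim G = 2 * n + 1" and c: "contact_form G br \<eta>"
    and N: "N = derived_ideal G br" "dim N + 1 = dim G"
  have sub: "subspace N" "N \<subseteq> G" using derived_ideal_carrier N by auto
  show "dim (lie_center N br) \<le> 2"
    by (rule contact_center_hyperplane(1)[OF c sub N(2)])
  show "\<exists>e \<in> G. \<not> (\<exists>c::real. \<forall>x \<in> lie_center N br. br e x = c *\<^sub>R x)"
    if "dim (lie_center N br) = 2"
    by (rule contact_center_hyperplane(2)[OF c sub N(2) that])
  obtain m where m: "n = Suc m" using n(1) by (cases n) auto
  have "nonzero_form_on N (contact_power br (n - 1) \<eta>)"
    using contact_form_derived_ideal[OF c] n(2) N m by simp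
  moreover have "linear_form_on N \<eta>"
    using c sub(2) linear_form_on_subset by (auto simp: contact_form_def)
  ultimately show "\<exists>\<alpha>. linear_form_on N \<alpha> \<and> nonzero_form_on N (contact_power br (n - 1) \<alpha>)"
    by blast
next
  interpret lie_algebra G br by fact
  fix A
  assume A: "lie_subalgebra A G br" "abelian_on A br" "dim A + 1 = dim G" "dim G \<ge> 4"
  show "\<not> (\<exists>\<eta>. contact_form G br \<eta>)" "\<not> (\<exists>\<omega>. exact_symplectic_form G br \<omega>)"
    using abelian_hyperplane_obstruction[OF A] by blast+
qed

end
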